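(* Let $f\colon M\to M$ be an expansive homeomorphism of a compact metric space and let $\mathrm{d}$ be a self-similar metric for $f$ with expanding factor $\lambda$. Then for every $X\subseteq M$ the limit defining the capacity $\mathrm{cap}(X,\mathrm{d})$ exists and $$\mathrm{cap}(X,\mathrm{d})=\frac{\mathrm{h}(X)}{\log(\lambda)}.$$
   Context: Self-similar metric: a metric $\mathrm{d}$ compatible with the topology of $M$ for which there are constants $\xi>0$ (an expansive constant) and $\lambda>1$ (the expanding factor) such that $\mathrm{d}(p,q)\le\xi$ implies $\max\{\mathrm{d}(f(p),f(q)),\mathrm{d}(f^{-1}(p),f^{-1}(q))\}=\lambda\,\mathrm{d}(p,q)$. Covers: for a metric $\rho$, $\epsilon>0$ and $X\subseteq M$, an $(\epsilon,\rho)$-cover of $X$ is a finite family $\{A_1,\dots,A_n\}$ with $\bigcup_i A_i=X$ and $\mathrm{diam}_\rho(A_i)<\epsilon$ for all $i$; $\mathrm{cov}_\epsilon(X,\rho)$ is the minimal cardinality of an $(\epsilon,\rho)$-cover of $X$. Entropy (non-standard, two-sided): $\mathrm{d}^f_n(x,y)=\max_{|k|\le n}\mathrm{d}(f^k(x),f^k(y))$ and $$\mathrm{h}(X)=\lim_{n\to+\infty}\frac1n\log(\mathrm{cov}_\xi(X,\mathrm{d}^f_n)).$$ It is a standing convention that this limit exists, is finite and does not depend on the choice of the expansive constant $\xi$. (For $X=M$, $\mathrm{h}(M)$ is twice the usual topological entropy of $f$.) Capacity: $\displaystyle\mathrm{cap}(X,\mathrm{d})=\lim_{\epsilon\to0}\frac{\log(\mathrm{cov}_\epsilon(X,\mathrm{d}))}{-\log(\epsilon)}$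 whenever this limit exists. *)

theory Defs
  imports "HOL-Analysis.Analysis"
begin

text \<open>
  Spaces are carrier sets \<open>M\<close> with a metric in the sense of the locale \<open>Metric_space\<close>; several
  metrics on the same carrier occur side by side, so metrics are explicit arguments throughout.
\<close>

definition int_iterate :: "'a set \<Rightarrow> ('a \<Rightarrow> 'a) \<Rightarrow> int \<Rightarrow> 'a \<Rightarrow> 'a" where
  "int_iterate M f k = (if 0 \<le> k then f ^^ nat k else inv_into M f ^^ nat (- k))"

definition expansive_constant :: "'a set \<Rightarrow> ('a \<Rightarrow> 'a) \<Rightarrow> ('a \<Rightarrow> 'a \<Rightarrow> real) \<Rightarrow> real \<Rightarrow> bool" where
  "expansive_constant M f d \<xi> \<longleftrightarrow> 0 < \<xi> \<and>
     (\<forall>p\<in>M. \<forall>q\<in>M. (\<forall>k. d (int_iterate M f k p) (int_iterate M f k q) \<le> \<xi>) \<longrightarrow> p = q)"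

definition expansive_homeomorphism :: "'a set \<Rightarrow> ('a \<Rightarrow> 'a \<Rightarrow> real) \<Rightarrow> ('a \<Rightarrow> 'a) \<Rightarrow> bool" where
  "expansive_homeomorphism M \<rho> f \<longleftrightarrow>
     homeomorphic_map (Metric_space.mtopology M \<rho>) (Metric_space.mtopology M \<rho>) f \<and>
     (\<exists>\<xi>. expansive_constant M f \<rho> \<xi>)"

definition self_similar_metric ::
    "'a set \<Rightarrow> 'a topology \<Rightarrow> ('a \<Rightarrow> 'a) \<Rightarrow> real \<Rightarrow> ('a \<Rightarrow> 'a \<Rightarrow> real) \<Rightarrow> bool" where
  "self_similar_metric M T f lam d \<longleftrightarrow>
     Metric_space M d \<and> Metric_space.mtopology M d = T \<and> 1 < lam \<and>
     (\<exists>\<xi>. expansive_constant M f d \<xi> \<and>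
       (\<forall>p\<in>M. \<forall>q\<in>M. d p q \<le> \<xi> \<longrightarrow>
          max (d (f p) (f q)) (d (inv_into M f p) (inv_into M f q)) = lam * d p q))"

text \<open>
  The library constant \<open>diameter\<close>, with \<open>dist\<close> replaced by an arbitrary metric. As there, the value
  is meaningful for bounded sets only; on a compact space every set is bounded.
\<close>

definition diam :: "('a \<Rightarrow> 'a \<Rightarrow> real) \<Rightarrow> 'a set \<Rightarrow> real" where
  "diam \<rho> A = (if A = {} then 0 else SUP (x, y)\<in>A \<times> A. \<rho> x y)"

text \<open>
  Covers are nonempty families, as in \<open>A\<^sub>1, \<dots>, A\<^sub>n\<close> with \<open>n \<ge> 1\<close>. Consequently \<open>cov \<epsilon> {} \<rho> = 1\<close>,
  and the empty set has entropy and capacity 0.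
\<close>

definition is_cover :: "real \<Rightarrow> ('a \<Rightarrow> 'a \<Rightarrow> real) \<Rightarrow> 'a set \<Rightarrow> 'a set set \<Rightarrow> bool" where
  "is_cover \<epsilon> \<rho> X \<A> \<longleftrightarrow> finite \<A> \<and> \<A> \<noteq> {} \<and> \<Union>\<A> = X \<and> (\<forall>A\<in>\<A>. diam \<rho> A < \<epsilon>)"

definition cov :: "real \<Rightarrow> 'a set \<Rightarrow> ('a \<Rightarrow> 'a \<Rightarrow> real) \<Rightarrow> nat" where
  "cov \<epsilon> X \<rho> = (LEAST n. \<exists>\<A>. is_cover \<epsilon> \<rho> X \<A> \<and> card \<A> = n)"

definition dyn_metric ::
    "'a set \<Rightarrow> ('a \<Rightarrow> 'a) \<Rightarrow> ('a \<Rightarrow> 'a \<Rightarrow> real) \<Rightarrow> nat \<Rightarrow> 'a \<Rightarrow> 'a \<Rightarrow> real" where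
  "dyn_metric M f d n x y =
     Max ((\<lambda>k. d (int_iterate M f k x) (int_iterate M f k y)) ` {k. \<bar>k\<bar> \<le> int n})"

definition entropy_seq ::
    "'a set \<Rightarrow> ('a \<Rightarrow> 'a) \<Rightarrow> ('a \<Rightarrow> 'a \<Rightarrow> real) \<Rightarrow> real \<Rightarrow> 'a set \<Rightarrow> nat \<Rightarrow> real" where
  "entropy_seq M f d \<xi> X n = 1 / real n * ln (real (cov \<xi> X (dyn_metric M f d n)))"

text \<open>
  The two-sided entropy at scale \<open>\<xi>\<close>; meaningful when \<open>entropy_seq M f d \<xi> X\<close> converges.
\<close>

definition entropy :: "'a set \<Rightarrow> ('a \<Rightarrow> 'a) \<Rightarrow> ('a \<Rightarrow> 'a \<Rightarrow> real) \<Rightarrow> real \<Rightarrow> 'a set \<Rightarrow> real" where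
  "entropy M f d \<xi> X = lim (entropy_seq M f d \<xi> X)"

definition capacity_quotient :: "'a set \<Rightarrow> ('a \<Rightarrow> 'a \<Rightarrow> real) \<Rightarrow> real \<Rightarrow> real" where
  "capacity_quotient X d \<epsilon> = ln (real (cov \<epsilon> X d)) / (- ln \<epsilon>)"

definition capacity :: "'a set \<Rightarrow> ('a \<Rightarrow> 'a \<Rightarrow> real) \<Rightarrow> real" where
  "capacity X d = Lim (at_right 0) (capacity_quotient X d)"

end

theory Submission
  imports Defs "HOL-Real_Asymp.Real_Asymp"
begin

text \<open>
  A self-similar metric turns time into scale. As long as two orbits stay within the self-similarity
  constant \<open>\<xi>\<^sub>0\<close> of each other, their distance grows by the exact factor \<open>\<lambda>\<close> per step in
  at least one time direction, and a pair of points that has once begun to separate in a direction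
  must go on separating in it: the neighbour one step back is closer by the factor \<open>\<lambda>\<close>, so it cannot
  realise the maximum in the self-similarity equation. Hence the two-sided dynamical metric over
  times \<open>|k| \<le> n\<close> is exactly \<open>\<lambda>\<^sup>n d\<close> wherever either of the two is at most \<open>\<xi>\<^sub>0\<close>
  (\<open>dyn_metric_le_iff_scaled\<close>), and for \<open>\<epsilon> \<le> \<xi>\<^sub>0\<close> a cover at scale \<open>\<epsilon>\<close> for the dynamical metric is
  the same thing as a cover at scale \<open>\<epsilon> / \<lambda>\<^sup>n\<close> for \<open>d\<close>. The entropy at scale \<open>\<epsilon>\<close> is therefore the
  growth rate of the covering numbers of \<open>d\<close> along the geometric scales \<open>\<epsilon> / \<lambda>\<^sup>n\<close>.

  Two gaps remain. The entropy is given at an arbitrary expansive constant \<open>\<xi>\<close>, which may exceed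
  \<open>\<xi>\<^sub>0\<close>. On a compact space expansivity is uniform (\<open>uniform_expansivity\<close>): closeness up to \<open>\<xi>\<close>
  over a fixed time window \<open>|k| \<le> N\<close> forces closeness up to any prescribed \<open>\<delta>\<close>. So passing from
  \<open>\<xi>\<close> to a smaller scale costs only a shift of time by \<open>N\<close> (\<open>cov_dyn_metric_refine\<close>), which does
  not change exponential growth rates. Finally, the capacity is a limit over all scales tending to
  \<open>0\<close>; covering numbers are monotone in the scale, so every scale can be squeezed between two
  consecutive geometric ones, whose logarithms differ by the bounded amount \<open>ln \<lambda>\<close>
  (\<open>capacity_limit_from_geometric_scales\<close>).
\<close>

section \<open>Geometric growth along an orbit pair\<close>

text \<open>
  In this section \<open>m k\<close> stands for the distance of the \<open>k\<close>-th iterates of two points. Only the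
  self-similarity equation matters, so the arguments are about a single sequence indexed by the
  integers. The maximum in that equation bounds both neighbours, which gives growth by at most \<open>lam\<close>
  per step away from time \<open>0\<close>.
\<close>

lemma orbit_distance_upper:
  fixes m :: "int \<Rightarrow> real"
  assumes exp: "\<And>k. m k \<le> \<xi> \<Longrightarrow> max (m (k + 1)) (m (k - 1)) = lam * m k"
    and lam: "1 < lam" and small: "\<And>k. \<bar>k\<bar> < int n \<Longrightarrow> m k \<le> \<xi>"
    and k: "\<bar>k\<bar> \<le> int n"
  shows "m k \<le> lam ^ nat \<bar>k\<bar> * m 0"
proof -
  have "m (int j) \<le> lam ^ j * m 0 \<and> m (- int j) \<le> lam ^ j * m 0" if "j \<le> n" for j
    using that
  proof (induction j)
    case (Suc j)
    have "m (int j) \<le> \<xi>" "m (- int j) \<le> \<xi>"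
      using Suc.prems small by auto
    then have "m (int j + 1) \<le> lam * m (int j)" "m (- int j - 1) \<le> lam * m (- int j)"
      using exp by (metis max.cobounded1, metis max.cobounded2)
    moreover have "lam * m (int j) \<le> lam * (lam ^ j * m 0)"
      "lam * m (- int j) \<le> lam * (lam ^ j * m 0)"
      using Suc lam by auto
    moreover have "int (Suc j) = int j + 1" "- int (Suc j) = - int j - 1" by auto
    ultimately show ?case
      by (metis mult.assoc order_trans power_Suc)
  qed simp
  from this[of "nat \<bar>k\<bar>"] k show ?thesis
    by (cases "k \<ge> 0") auto
qed

text \<open>
  Once the factor \<open>lam\<close> is realised by the step from \<open>0\<close> to \<open>1\<close>, it is realised by all later steps:
  the previous value is already smaller than the current one, so the next one must be the maximum.
\<close>

lemma orbit_distance_forward: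
  fixes m :: "int \<Rightarrow> real"
  assumes exp: "\<And>k. m k \<le> \<xi> \<Longrightarrow> max (m (k + 1)) (m (k - 1)) = lam * m k"
    and lam: "1 < lam" and nonneg: "\<And>k. 0 \<le> m k"
    and small: "\<And>k. \<bar>k\<bar> < int n \<Longrightarrow> m k \<le> \<xi>"
    and start: "m 1 = lam * m 0" and j: "j < n"
  shows "m (int j) = lam ^ j * m 0 \<and> m (int (Suc j)) = lam ^ Suc j * m 0"
  using j
proof (induction j)
  case (Suc j)
  have "m (int (Suc j)) \<le> \<xi>" using Suc.prems small by auto
  then have mx: "max (m (int (Suc (Suc j)))) (m (int j)) = lam * m (int (Suc j))"
    using exp[of "int (Suc j)"] by (simp add: algebra_simps)
  have eq: "m (int (Suc j)) = lam * m (int j)"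
    using Suc by simp
  \<comment> \<open>If the previous value were the maximum, it would equal \<open>lam\<close> times the current one, which forces all three values to vanish.\<close>
  have "m (int j) \<le> m (int (Suc j))" "m (int (Suc j)) \<le> lam * m (int (Suc j))"
    using eq mult_right_mono[of 1 lam "m (int j)"] mult_right_mono[of 1 lam "m (int (Suc j))"]
      nonneg lam by simp_all
  then have "m (int (Suc (Suc j))) = lam * m (int (Suc j))"
    using mx nonneg[of "int (Suc (Suc j))"] nonneg[of "int (Suc j)"] nonneg[of "int j"] lam
      eq mult_le_cancel_right1[of "m (int (Suc j))" lam] 
    by (smt (verit) mult_cancel_right1)
  then show ?case using Suc by simp
qed (use start in simp)

text \<open>
  The first step realises the factor \<open>lam\<close> in one of the two time directions; reversing time if
  needed, the growth goes on in that direction for the whole time window.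
\<close>

lemma orbit_distance_attained:
  fixes m :: "int \<Rightarrow> real"
  assumes exp: "\<And>k. m k \<le> \<xi> \<Longrightarrow> max (m (k + 1)) (m (k - 1)) = lam * m k"
    and lam: "1 < lam" and nonneg: "\<And>k. 0 \<le> m k"
    and small: "\<And>k. \<bar>k\<bar> < int n \<Longrightarrow> m k \<le> \<xi>"
  shows "\<exists>k. \<bar>k\<bar> = int n \<and> m k = lam ^ n * m 0"
proof (cases n)
  case (Suc j)
  have "max (m 1) (m (- 1)) = lam * m 0"
    using exp[of 0] small[of 0] Suc by simp
  then consider "m 1 = lam * m 0" | "m (- 1) = lam * m 0" by (metis max_def)
  then show ?thesis
  proof cases
    case 1
    then show ?thesis
      using orbit_distance_forward[OF exp lam nonneg small 1, of n j] Suc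
      by (intro exI[of _ "int n"]) auto
  next
    case 2
    have exp': "max (m (- (k + 1))) (m (- (k - 1))) = lam * m (- k)" if "m (- k) \<le> \<xi>" for k
      using exp[OF that] by (metis add.commute diff_minus_eq_add max.commute minus_add_distrib
          minus_diff_eq uminus_add_conv_diff diff_conv_add_uminus)
    show ?thesis
      using orbit_distance_forward[of "\<lambda>k. m (- k)" \<xi> lam n j, OF exp' lam nonneg] small 2 Suc
      by (intro exI[of _ "- int n"]) auto
  qed
qed auto

text \<open>
  The upper bound at all times and its attainment at time \<open>n\<close> or \<open>-n\<close> together say that the maximum
  over the window is \<open>lam ^ n * m 0\<close>. Phrasing this through sublevels \<open>r \<le> \<xi>\<close> makes the range of
  validity explicit, for which either side of the equivalence may serve as the hypothesis.
\<close>

lemma orbit_distances_le_iff: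
  fixes m :: "int \<Rightarrow> real"
  assumes exp: "\<And>k. m k \<le> \<xi> \<Longrightarrow> max (m (k + 1)) (m (k - 1)) = lam * m k"
    and lam: "1 < lam" and nonneg: "\<And>k. 0 \<le> m k" and r: "r \<le> \<xi>"
  shows "(\<forall>k. \<bar>k\<bar> \<le> int n \<longrightarrow> m k \<le> r) \<longleftrightarrow> lam ^ n * m 0 \<le> r"
proof
  assume *: "\<forall>k. \<bar>k\<bar> \<le> int n \<longrightarrow> m k \<le> r"
  then have "\<exists>k. \<bar>k\<bar> = int n \<and> m k = lam ^ n * m 0"
    using r by (intro orbit_distance_attained[where \<xi> = \<xi>, OF exp lam nonneg])
      (meson less_imp_le order_trans)+
  then show "lam ^ n * m 0 \<le> r" using * by (metis order_refl)
next
  assume "lam ^ n * m 0 \<le> r"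
  then show "\<forall>k. \<bar>k\<bar> \<le> int n \<longrightarrow> m k \<le> r"
  proof (induction n)
    case (Suc n)
    have mono: "lam ^ i * m 0 \<le> r" if "i \<le> Suc n" for i
    proof -
      have "lam ^ i * m 0 \<le> lam ^ Suc n * m 0"
        using that lam nonneg by (intro mult_right_mono power_increasing) auto
      then show ?thesis using Suc.prems by linarith
    qed
    have "m k \<le> \<xi>" if "\<bar>k\<bar> < int (Suc n)" for k
    proof -
      have "\<bar>k\<bar> \<le> int n" using that by simp
      then show ?thesis using Suc.IH[OF mono[of n]] r by (meson le_SucI order_refl order_trans)
    qed
    then have "m k \<le> lam ^ nat \<bar>k\<bar> * m 0" if "\<bar>k\<bar> \<le> int (Suc n)" for k
      using orbit_distance_upper[OF exp lam _ that] by blast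
    then show ?case using mono by (meson nat_le_iff order_trans)
  qed simp
qed

section \<open>Integer iterates and dynamical metrics\<close>

lemma int_iterate_0 [simp]: "int_iterate M f 0 x = x"
  by (simp add: int_iterate_def)

lemma int_iterate_closed:
  assumes "bij_betw f M M" "x \<in> M"
  shows "int_iterate M f k x \<in> M"
proof -
  have "(g ^^ n) x \<in> M" if "bij_betw g M M" for g n
    using that assms(2) by (induction n) (auto dest: bij_betwE)
  then show ?thesis
    using assms(1) bij_betw_inv_into[OF assms(1)] by (simp add: int_iterate_def)
qed

lemma int_iterate_Suc:
  assumes "bij_betw f M M" "x \<in> M"
  shows "int_iterate M f (k + 1) x = f (int_iterate M f k x)"
proof (cases "k \<ge> 0")
  case True
  then show ?thesis by (simp add: int_iterate_def nat_add_distrib)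
next
  case False
  define n where "n = nat (- k - 1)"
  have k: "k = - int (Suc n)" using False n_def by auto
  have "int_iterate M f (k + 1) x = (inv_into M f ^^ n) x"
    using k by (auto simp: int_iterate_def)
  moreover from this have "(inv_into M f ^^ n) x \<in> M"
    using int_iterate_closed[OF assms] by metis
  ultimately show ?thesis
    using assms k by (simp add: int_iterate_def bij_betw_inv_into_right nat_add_distrib)
qed

lemma int_iterate_pred:
  assumes "bij_betw f M M" "x \<in> M"
  shows "int_iterate M f (k - 1) x = inv_into M f (int_iterate M f k x)"
  using int_iterate_Suc[OF assms, of "k - 1"] int_iterate_closed[OF assms, of "k - 1"] assms(1)
  by (simp add: bij_betw_inv_into_left)

lemma int_iterate_add:
  assumes "bij_betw f M M" "x \<in> M"
  shows "int_iterate M f (j + k) x = int_iterate M f j (int_iterate M f k x)"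
proof (induction j rule: int_induct[where k = 0])
  case (step1 i)
  then show ?case
    using int_iterate_Suc[OF assms, of "i + k"]
      int_iterate_Suc[OF assms(1) int_iterate_closed[OF assms, of k], of i]
    by (simp add: algebra_simps)
next
  case (step2 i)
  then show ?case
    using int_iterate_pred[OF assms, of "i + k"]
      int_iterate_pred[OF assms(1) int_iterate_closed[OF assms, of k], of i]
    by (simp add: algebra_simps)
qed simp

lemma continuous_map_int_iterate:
  assumes "homeomorphic_map T T f"
  shows "continuous_map T T (int_iterate (topspace T) f k)"
proof -
  obtain g where g: "homeomorphic_maps T T f g"
    using assms homeomorphic_map_maps by blast
  have "inv_into (topspace T) f y = g y" if "y \<in> topspace T" for y
    using g that assms unfolding homeomorphic_maps_def
    by (metis continuous_map_image_subset_topspace homeomorphic_imp_injective_map image_subset_iff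
        inv_into_f_eq)
  then have "continuous_map T T (inv_into (topspace T) f)"
    using g continuous_map_eq unfolding homeomorphic_maps_def by metis
  moreover have "continuous_map T T (h ^^ n)" if "continuous_map T T h" for h n
    using that by (induction n) (auto simp: id_def intro: continuous_map_compose)
  ultimately show ?thesis
    using assms homeomorphic_imp_continuous_map[of T T f] by (auto simp: int_iterate_def)
qed

lemma dyn_metric_le_iff:
  "dyn_metric M f d n x y \<le> c \<longleftrightarrow>
    (\<forall>k. \<bar>k\<bar> \<le> int n \<longrightarrow> d (int_iterate M f k x) (int_iterate M f k y) \<le> c)"
proof -
  have "{k. \<bar>k\<bar> \<le> int n} = {- int n..int n}" by auto
  then have "finite {k. \<bar>k\<bar> \<le> int n}" by simp
  moreover have "0 \<in> {k. \<bar>k\<bar> \<le> int n}" by simp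
  ultimately show ?thesis
    unfolding dyn_metric_def by (subst Max_le_iff) blast+
qed

text \<open>
  The key exchange of time for scale: within the range of the self-similarity equation, the
  dynamical metric is \<open>d\<close> magnified by \<open>lam ^ n\<close>.
\<close>

lemma dyn_metric_le_iff_scaled:
  assumes "Metric_space M d" "bij_betw f M M" "1 < lam"
    and exp: "\<And>p q. p \<in> M \<Longrightarrow> q \<in> M \<Longrightarrow> d p q \<le> \<xi> \<Longrightarrow>
      max (d (f p) (f q)) (d (inv_into M f p) (inv_into M f q)) = lam * d p q"
    and "x \<in> M" "y \<in> M" "r \<le> \<xi>"
  shows "dyn_metric M f d n x y \<le> r \<longleftrightarrow> lam ^ n * d x y \<le> r"
proof -
  interpret Metric_space M d by fact
  define m where "m k = d (int_iterate M f k x) (int_iterate M f k y)" for k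
  have "max (m (k + 1)) (m (k - 1)) = lam * m k" if "m k \<le> \<xi>" for k
    using that exp[OF int_iterate_closed[OF assms(2,5)] int_iterate_closed[OF assms(2,6)]] assms
    unfolding m_def by (simp add: int_iterate_Suc int_iterate_pred)
  then show ?thesis
    unfolding dyn_metric_le_iff
    using orbit_distances_le_iff[of m \<xi> lam r n] assms by (simp add: m_def)
qed

text \<open>
  The pairs at distance at least \<open>\<delta>\<close> form a compact set. By expansivity it is covered by the open
  sets of pairs that are more than \<open>\<xi>\<close> apart at time \<open>k\<close>; finitely many \<open>k\<close> suffice, and \<open>N\<close>
  bounds them.
\<close>

lemma uniform_expansivity:
  assumes "Metric_space M d"
    and comp: "compact_space (Metric_space.mtopology M d)"
    and homeo: "homeomorphic_map (Metric_space.mtopology M d) (Metric_space.mtopology M d) f"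
    and expa: "expansive_constant M f d \<xi>" and "0 < \<delta>"
  shows "\<exists>N. \<forall>x\<in>M. \<forall>y\<in>M. dyn_metric M f d N x y \<le> \<xi> \<longrightarrow> d x y \<le> \<delta>"
proof -
  interpret Metric_space M d by fact
  let ?P = "prod_topology mtopology mtopology"
  define D where "D k z = d (int_iterate M f k (fst z)) (int_iterate M f k (snd z))" for k z
  define U where "U k = {z \<in> M \<times> M. \<xi> < D k z}" for k
  define K where "K = {z \<in> M \<times> M. \<delta> \<le> D 0 z}"
  have it: "continuous_map mtopology mtopology (int_iterate M f k)" for k
    using continuous_map_int_iterate[OF homeo, of k] by simp
  have cont: "continuous_map ?P euclideanreal (D k)" for k
  proof -
    have "continuous_map ?P mtopology (int_iterate M f k \<circ> fst)"
      "continuous_map ?P mtopology (int_iterate M f k \<circ> snd)"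
      by (rule continuous_map_compose[OF _ it], simp add: continuous_map_fst continuous_map_snd)+
    then show ?thesis
      using continuous_map_mdist[of ?P Self] by (simp add: Self_def D_def[abs_def] o_def)
  qed
  have "openin ?P (U k)" for k
    using cont[of k] unfolding continuous_map_upper_lower_semicontinuous_lt U_def by simp
  moreover have "closedin ?P K"
    using cont[of 0] unfolding continuous_map_upper_lower_semicontinuous_le K_def by simp
  then have "compactin ?P K"
    using comp by (simp add: closedin_compact_space compact_space_prod_topology)
  moreover have "K \<subseteq> \<Union> (range U)"
  proof
    fix z assume z: "z \<in> K"
    then have "fst z \<noteq> snd z" "fst z \<in> M" "snd z \<in> M"
      using \<open>0 < \<delta>\<close> by (auto simp: K_def D_def)
    then obtain k where "\<not> D k z \<le> \<xi>"
      using expa unfolding expansive_constant_def D_def by blast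
    then show "z \<in> \<Union> (range U)" using z by (auto simp: U_def K_def intro!: exI[of _ k])
  qed
  ultimately obtain F where F: "finite F" "F \<subseteq> range U" "K \<subseteq> \<Union> F"
    unfolding compactin_def by (metis rangeE)
  then obtain I where I: "finite I" "F = U ` I"
    by (metis finite_subset_image)
  define N where "N = Max (insert 0 ((\<lambda>k. nat \<bar>k\<bar>) ` I))"
  have "nat \<bar>k\<bar> \<le> N" if "k \<in> I" for k
    using that I by (auto simp: N_def intro!: Max_ge)
  then have N: "\<bar>k\<bar> \<le> int N" if "k \<in> I" for k
    using that by (simp add: nat_le_iff)
  show ?thesis
  proof (intro exI[of _ N] ballI impI)
    fix x y assume xy: "x \<in> M" "y \<in> M" and le: "dyn_metric M f d N x y \<le> \<xi>"
    have "(x, y) \<notin> K"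
    proof
      assume "(x, y) \<in> K"
      then obtain k where "k \<in> I" "(x, y) \<in> U k" using F I by blast
      then show False using le N unfolding dyn_metric_le_iff by (force simp: U_def D_def)
    qed
    then show "d x y \<le> \<delta>" using xy by (simp add: K_def D_def)
  qed
qed

section \<open>Diameters and covering numbers\<close>

text \<open>
  Boundedness makes the supremum meaningful. The right-hand side speaks of upper bounds for the
  distances only, which is the form in which different metrics can be compared; the gap between \<open>r\<close>
  and \<open>\<epsilon>\<close> reflects that the supremum need not be attained.
\<close>

lemma diam_less_iff:
  assumes "0 < \<epsilon>" and bdd: "\<And>x y. x \<in> A \<Longrightarrow> y \<in> A \<Longrightarrow> \<rho> x y \<le> B"
  shows "diam \<rho> A < \<epsilon> \<longleftrightarrow> (\<exists>r<\<epsilon>. \<forall>x\<in>A. \<forall>y\<in>A. \<rho> x y \<le> r)"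
proof (cases "A = {}")
  case True
  then show ?thesis using assms by (auto simp: diam_def)
next
  case False
  let ?S = "(\<lambda>(x, y). \<rho> x y) ` (A \<times> A)"
  have "bdd_above ?S" using bdd by (auto intro!: bdd_aboveI[of _ B])
  then have "diam \<rho> A \<le> r \<longleftrightarrow> (\<forall>x\<in>A. \<forall>y\<in>A. \<rho> x y \<le> r)" for r
    using False by (subst diam_def) (auto simp: cSUP_le_iff)
  then show ?thesis by (meson le_less_trans order_refl)
qed

text \<open>
  An optimal cover for \<open>\<sigma>\<close> is a cover for \<open>\<rho>\<close>. The existence of some cover is essential: without
  one, the least cardinality on the right would be unspecified.
\<close>

lemma cov_mono:
  assumes cover: "is_cover \<delta> \<sigma> X \<A>"
    and imp: "\<And>A. A \<subseteq> X \<Longrightarrow> diam \<sigma> A < \<delta> \<Longrightarrow> diam \<rho> A < \<epsilon>"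
  shows "cov \<epsilon> X \<rho> \<le> cov \<delta> X \<sigma>"
proof -
  have "\<exists>\<A>. is_cover \<delta> \<sigma> X \<A> \<and> card \<A> = cov \<delta> X \<sigma>"
    unfolding cov_def by (rule LeastI[where k = "card \<A>"]) (use cover in blast)
  then obtain \<B> where "is_cover \<delta> \<sigma> X \<B>" "card \<B> = cov \<delta> X \<sigma>"
    by blast
  moreover from this imp have "is_cover \<epsilon> \<rho> X \<B>"
    unfolding is_cover_def by blast
  ultimately show ?thesis
    unfolding cov_def by (metis (mono_tags, lifting) Least_le)
qed

lemma cov_pos:
  assumes "is_cover \<epsilon> \<rho> X \<A>"
  shows "0 < cov \<epsilon> X \<rho>"
proof -
  have "\<exists>\<A>. is_cover \<epsilon> \<rho> X \<A> \<and> card \<A> = cov \<epsilon> X \<rho>"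
    unfolding cov_def by (rule LeastI[where k = "card \<A>"]) (use assms in blast)
  then show ?thesis
    by (metis card_gt_0_iff is_cover_def)
qed

lemma is_cover_exists:
  assumes "Metric_space M d" and comp: "compact_space (Metric_space.mtopology M d)"
    and "X \<subseteq> M" "0 < \<epsilon>"
  shows "\<exists>\<A>. is_cover \<epsilon> d X \<A>"
proof -
  interpret Metric_space M d by fact
  have "mtotally_bounded M"
    using comp compactin_imp_mtotally_bounded by (simp add: compact_space_def)
  then obtain K where K: "finite K" "K \<subseteq> M" "M \<subseteq> (\<Union>x\<in>K. mball x (\<epsilon> / 3))"
    unfolding mtotally_bounded_def using \<open>0 < \<epsilon>\<close> by (metis zero_less_divide_iff zero_less_numeral)
  \<comment> \<open>The empty set keeps the family nonempty when \<open>M\<close> is empty.\<close>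
  define \<A> where "\<A> = insert {} ((\<lambda>x. mball x (\<epsilon> / 3) \<inter> X) ` K)"
  have "diam d A < \<epsilon>" if "A \<in> \<A>" for A
  proof -
    have "d x y \<le> 2 * \<epsilon> / 3" if xy: "x \<in> A" "y \<in> A" for x y
    proof -
      obtain z where "z \<in> M" "x \<in> M" "y \<in> M" "d z x < \<epsilon> / 3" "d z y < \<epsilon> / 3"
        using \<open>A \<in> \<A>\<close> xy by (auto simp: \<A>_def)
      then show ?thesis using triangle[of x z y] commute[of x z] by linarith
    qed
    then show ?thesis
      using \<open>0 < \<epsilon>\<close> by (subst diam_less_iff[where B = "2 * \<epsilon> / 3"]) (auto intro!: exI[of _ "2 * \<epsilon> / 3"])
  qed
  moreover have "\<Union> \<A> = X" using K \<open>X \<subseteq> M\<close> by (auto simp: \<A>_def)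
  ultimately have "is_cover \<epsilon> d X \<A>"
    using K by (auto simp: is_cover_def \<A>_def)
  then show ?thesis by blast
qed

section \<open>Limits along geometric scales and shifted times\<close>

text \<open>
  Here \<open>G\<close> is the logarithm of a covering number as a function of the scale. For a small scale \<open>e\<close>
  let \<open>N e\<close> be the integer part of \<open>t e = ln (\<epsilon> / e) / ln lam\<close>. Then \<open>e\<close> lies between the geometric
  scales with exponents \<open>N e + 1\<close> and \<open>N e\<close>, both of which are asymptotic to \<open>- ln e / ln lam\<close>, so
  monotonicity of \<open>G\<close> squeezes the quotient.
\<close>

lemma capacity_limit_from_geometric_scales:
  fixes G :: "real \<Rightarrow> real"
  assumes "1 < lam" "0 < \<epsilon>"
    and anti: "\<And>a b. 0 < a \<Longrightarrow> a \<le> b \<Longrightarrow> G b \<le> G a"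
    and lim: "(\<lambda>n. G (\<epsilon> / lam ^ n) / real n) \<longlonglongrightarrow> h"
  shows "((\<lambda>e. G e / (- ln e)) \<longlongrightarrow> h / ln lam) (at_right 0)"
proof -
  define l where "l = ln lam"
  define t where "t e = (ln \<epsilon> - ln e) / l" for e
  define N where "N e = nat \<lfloor>t e\<rfloor>" for e
  define g where "g = (\<lambda>n. G (\<epsilon> / lam ^ n) / real n)"
  have l: "0 < l" using assms by (simp add: l_def)
  have small: "\<forall>\<^sub>F e in at_right 0. 0 < e \<and> e < 1 \<and> e < \<epsilon>"
    using eventually_at_right_real[of 0 "min 1 \<epsilon>"] \<open>0 < \<epsilon>\<close> by (auto elim!: eventually_mono)
  have t_top: "filterlim t at_top (at_right 0)"
    unfolding t_def using l by real_asymp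
  have N_top: "filterlim N at_top (at_right 0)"
    unfolding N_def
    by (intro filterlim_compose[OF filterlim_nat_sequentially]
        filterlim_compose[OF filterlim_floor_sequentially] t_top)
  have t_ratio: "((\<lambda>e. t e / (- ln e)) \<longlongrightarrow> 1 / l) (at_right 0)"
    "((\<lambda>e. (t e - 1) / (- ln e)) \<longlongrightarrow> 1 / l) (at_right 0)"
    unfolding t_def using l by (real_asymp simp: divide_simps)+
  have N_bounds: "real (N e) \<le> t e" "t e < real (N e) + 1" if "0 < e" "e < \<epsilon>" for e
  proof -
    have "0 \<le> t e" using that l by (simp add: t_def)
    then show "real (N e) \<le> t e" "t e < real (N e) + 1" unfolding N_def by linarith+
  qed
  have N_ratio: "((\<lambda>e. real (N e) / (- ln e)) \<longlongrightarrow> 1 / l) (at_right 0)"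
  proof (rule tendsto_sandwich[OF _ _ t_ratio(2,1)])
    show "\<forall>\<^sub>F e in at_right 0. (t e - 1) / (- ln e) \<le> real (N e) / (- ln e)"
      using small by eventually_elim
        (intro divide_right_mono, use N_bounds in \<open>force intro: less_imp_le\<close>, simp)
    show "\<forall>\<^sub>F e in at_right 0. real (N e) / (- ln e) \<le> t e / (- ln e)"
      using small by eventually_elim (intro divide_right_mono, use N_bounds in force, simp)
  qed
  have "((\<lambda>e. 1 / (- ln e)) \<longlongrightarrow> 0) (at_right (0::real))"
    by real_asymp
  from tendsto_add[OF N_ratio this]
  have SN_ratio: "((\<lambda>e. real (Suc (N e)) / (- ln e)) \<longlongrightarrow> 1 / l) (at_right 0)"
    by (simp add: add_divide_distrib add.commute diff_divide_distrib)
  have g: "g \<longlonglongrightarrow> h" using lim by (simp add: g_def)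
  have g_lim: "((\<lambda>e. g (N e)) \<longlongrightarrow> h) (at_right 0)" "((\<lambda>e. g (Suc (N e))) \<longlongrightarrow> h) (at_right 0)"
    using filterlim_compose[OF g N_top] filterlim_compose[OF LIMSEQ_Suc[OF g] N_top] by simp_all
  have N_pos: "\<forall>\<^sub>F e in at_right 0. 0 < N e"
    using N_top eventually_compose_filterlim[OF eventually_gt_at_top[of 0]] by blast
  have scales: "\<epsilon> / lam ^ Suc (N e) \<le> e \<and> e \<le> \<epsilon> / lam ^ N e" if e: "0 < e" "e < \<epsilon>" for e
  proof -
    have "real (N e) * l \<le> ln \<epsilon> - ln e" "ln \<epsilon> - ln e \<le> real (Suc (N e)) * l"
      using N_bounds[OF e] l by (simp_all add: t_def field_simps)
    then have "ln (lam ^ N e) \<le> ln (\<epsilon> / e)" "ln (\<epsilon> / e) \<le> ln (lam ^ Suc (N e))"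
      using e assms by (simp_all only: l_def ln_realpow ln_divide_pos)
    then have "lam ^ N e \<le> \<epsilon> / e" "\<epsilon> / e \<le> lam ^ Suc (N e)"
      using e assms by (subst (asm) ln_le_cancel_iff; simp)+
    then show ?thesis using e assms by (simp add: field_simps)
  qed
  have "((\<lambda>e. G e / (- ln e)) \<longlongrightarrow> h * (1 / l)) (at_right 0)"
  proof (rule tendsto_sandwich[OF _ _ tendsto_mult[OF g_lim(1) N_ratio] tendsto_mult[OF g_lim(2) SN_ratio]])
    show "\<forall>\<^sub>F e in at_right 0. g (N e) * (real (N e) / - ln e) \<le> G e / - ln e"
      using small N_pos
    proof eventually_elim
      case (elim e)
      have "g (N e) * real (N e) \<le> G e"
        using anti[of e "\<epsilon> / lam ^ N e"] scales[of e] elim by (simp add: g_def)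
      then show ?case
        using elim divide_right_mono[of _ _ "- ln e"] by fastforce
    qed
    show "\<forall>\<^sub>F e in at_right 0. G e / - ln e \<le> g (Suc (N e)) * (real (Suc (N e)) / - ln e)"
      using small
    proof eventually_elim
      case (elim e)
      have "G e \<le> g (Suc (N e)) * real (Suc (N e))"
        using anti[of "\<epsilon> / lam ^ Suc (N e)" e] scales[of e] elim assms by (simp add: g_def)
      then show ?case
        using elim divide_right_mono[of _ _ "- ln e"] by fastforce
    qed
  qed
  then show ?thesis by (simp add: l_def)
qed

text \<open>A bounded shift of time is invisible to the growth rate, since \<open>(n + N) / n\<close> tends to \<open>1\<close>.\<close>

lemma tendsto_linear_rate_shift:
  fixes a b :: "nat \<Rightarrow> real"
  assumes lim: "(\<lambda>n. a n / real n) \<longlonglongrightarrow> h"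
    and "\<And>n. a n \<le> b n" "\<And>n. b n \<le> a (n + N)"
  shows "(\<lambda>n. b n / real n) \<longlonglongrightarrow> h"
proof (rule tendsto_sandwich[OF _ _ lim])
  have "(\<lambda>n. a (n + N) / real (n + N)) \<longlonglongrightarrow> h"
    using LIMSEQ_ignore_initial_segment[OF lim] .
  moreover have "(\<lambda>n. real (n + N) / real n) \<longlonglongrightarrow> 1"
    by real_asymp
  ultimately have "(\<lambda>n. a (n + N) / real (n + N) * (real (n + N) / real n)) \<longlonglongrightarrow> h * 1"
    by (rule tendsto_mult)
  moreover have "\<forall>\<^sub>F n in sequentially. a (n + N) / real (n + N) * (real (n + N) / real n) = a (n + N) / real n"
    using eventually_gt_at_top[of 0] by eventually_elim simp
  ultimately show "(\<lambda>n. a (n + N) / real n) \<longlonglongrightarrow> h"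
    using Lim_transform_eventually by fastforce
qed (use assms in \<open>auto intro!: always_eventually divide_right_mono\<close>)

section \<open>Covering numbers of dynamical metrics\<close>

text \<open>
  The exchange of time for scale, lifted from pairs of points to sets: a bound \<open>r\<close> for the dynamical
  distances corresponds to the bound \<open>r / lam ^ n\<close> for \<open>d\<close>.
\<close>

lemma diam_dyn_metric_less_iff_scaled:
  assumes M: "Metric_space M d" and bij: "bij_betw f M M" and lam: "1 < lam"
    and exp: "\<And>p q. p \<in> M \<Longrightarrow> q \<in> M \<Longrightarrow> d p q \<le> \<xi> \<Longrightarrow>
      max (d (f p) (f q)) (d (inv_into M f p) (inv_into M f q)) = lam * d p q"
    and B: "\<And>x y. x \<in> M \<Longrightarrow> y \<in> M \<Longrightarrow> d x y \<le> B"
    and \<epsilon>: "0 < \<epsilon>" "\<epsilon> \<le> \<xi>" and A: "A \<subseteq> M"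
  shows "diam (dyn_metric M f d n) A < \<epsilon> \<longleftrightarrow> diam d A < \<epsilon> / lam ^ n"
proof -
  let ?D = "dyn_metric M f d n"
  have BD: "?D x y \<le> B" if "x \<in> M" "y \<in> M" for x y
    using that B by (simp add: dyn_metric_le_iff int_iterate_closed[OF bij])
  have lam_n: "0 < lam ^ n" using lam by simp
  have scale: "?D x y \<le> r \<longleftrightarrow> d x y \<le> r / lam ^ n" if "r < \<epsilon>" "x \<in> A" "y \<in> A" for x y r
  proof -
    have "x \<in> M" "y \<in> M" "r \<le> \<xi>" using that A \<epsilon> by auto
    from dyn_metric_le_iff_scaled[OF M bij lam exp this, of n] show ?thesis
      using lam_n by (simp add: pos_le_divide_eq mult.commute)
  qed
  have "diam ?D A < \<epsilon> \<longleftrightarrow> (\<exists>r<\<epsilon>. \<forall>x\<in>A. \<forall>y\<in>A. ?D x y \<le> r)"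
    by (rule diam_less_iff[where B = B, OF \<epsilon>(1)]) (meson BD A subsetD)
  also have "\<dots> \<longleftrightarrow> (\<exists>r<\<epsilon>. \<forall>x\<in>A. \<forall>y\<in>A. d x y \<le> r / lam ^ n)"
    using scale by blast
  also have "\<dots> \<longleftrightarrow> (\<exists>r<\<epsilon> / lam ^ n. \<forall>x\<in>A. \<forall>y\<in>A. d x y \<le> r)" (is "?L \<longleftrightarrow> ?R")
  proof
    assume ?L
    then obtain r where "r < \<epsilon>" "\<forall>x\<in>A. \<forall>y\<in>A. d x y \<le> r / lam ^ n" by blast
    then show ?R using lam_n by (intro exI[of _ "r / lam ^ n"]) (simp add: divide_strict_right_mono)
  next
    assume ?R
    then obtain r where "r < \<epsilon> / lam ^ n" "\<forall>x\<in>A. \<forall>y\<in>A. d x y \<le> r" by blast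
    then show ?L using lam_n by (intro exI[of _ "r * lam ^ n"]) (use lam in \<open>simp add: pos_less_divide_eq\<close>)
  qed
  also have "\<dots> \<longleftrightarrow> diam d A < \<epsilon> / lam ^ n"
    by (rule diam_less_iff[where B = B, symmetric]) (use \<epsilon> lam_n in simp, meson B A subsetD)
  finally show ?thesis .
qed

text \<open>
  Uniform expansivity, applied along the orbit at each time \<open>|k| \<le> n\<close>, uses the times \<open>j + k\<close> with
  \<open>|j| \<le> N\<close>. Hence a set that is small at scale \<open>\<xi>\<close> over the window \<open>n + N\<close> is small at scale \<open>\<epsilon>\<close>
  over the window \<open>n\<close>. Bounding distances by \<open>\<epsilon> / 2\<close> leaves room for the strict inequality in
  the definition of a cover.
\<close>

lemma cov_dyn_metric_refine:
  assumes M: "Metric_space M d" and comp: "compact_space (Metric_space.mtopology M d)"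
    and homeo: "homeomorphic_map (Metric_space.mtopology M d) (Metric_space.mtopology M d) f"
    and expa: "expansive_constant M f d \<xi>" and "X \<subseteq> M" "0 < \<epsilon>"
    and cover: "\<And>n. \<exists>\<A>. is_cover \<xi> (dyn_metric M f d n) X \<A>"
  shows "\<exists>N. \<forall>n. cov \<epsilon> X (dyn_metric M f d n) \<le> cov \<xi> X (dyn_metric M f d (n + N))"
proof -
  interpret Metric_space M d by fact
  let ?D = "dyn_metric M f d"
  have bij: "bij_betw f M M"
    using homeo by (metis bij_betw_def homeomorphic_eq_everything_map topspace_mtopology)
  have "0 < \<xi>" using expa by (simp add: expansive_constant_def)
  obtain B where B: "\<And>x y. x \<in> M \<Longrightarrow> y \<in> M \<Longrightarrow> d x y \<le> B"
    using compactin_imp_mbounded[of M] comp mbounded_alt[of M] by (auto simp: compact_space_def)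
  have BD: "?D n x y \<le> B" if "x \<in> M" "y \<in> M" for n x y
    using that B by (simp add: dyn_metric_le_iff int_iterate_closed[OF bij])
  obtain N where N: "\<And>x y. x \<in> M \<Longrightarrow> y \<in> M \<Longrightarrow> ?D N x y \<le> \<xi> \<Longrightarrow> d x y \<le> \<epsilon> / 2"
    using uniform_expansivity[OF M comp homeo expa, of "\<epsilon> / 2"] \<open>0 < \<epsilon>\<close> by auto
  have refine: "?D n x y \<le> \<epsilon> / 2" if xy: "x \<in> M" "y \<in> M" and le: "?D (n + N) x y \<le> \<xi>" for n x y
    unfolding dyn_metric_le_iff
  proof (intro allI impI)
    fix k :: int assume k: "\<bar>k\<bar> \<le> int n"
    have "?D N (int_iterate M f k x) (int_iterate M f k y) \<le> \<xi>"
      unfolding dyn_metric_le_iff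
    proof (intro allI impI)
      fix j :: int assume "\<bar>j\<bar> \<le> int N"
      then have "\<bar>j + k\<bar> \<le> int (n + N)" using k by linarith
      then have "d (int_iterate M f (j + k) x) (int_iterate M f (j + k) y) \<le> \<xi>"
        using le unfolding dyn_metric_le_iff by blast
      then show "d (int_iterate M f j (int_iterate M f k x)) (int_iterate M f j (int_iterate M f k y)) \<le> \<xi>"
        using int_iterate_add[OF bij] xy by metis
    qed
    then show "d (int_iterate M f k x) (int_iterate M f k y) \<le> \<epsilon> / 2"
      using N int_iterate_closed[OF bij] xy by blast
  qed
  have "diam (?D n) A < \<epsilon>" if A: "A \<subseteq> X" and small: "diam (?D (n + N)) A < \<xi>" for A n
  proof -
    have AM: "A \<subseteq> M" using A \<open>X \<subseteq> M\<close> by blast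
    have "diam (?D (n + N)) A < \<xi> \<longleftrightarrow> (\<exists>r<\<xi>. \<forall>x\<in>A. \<forall>y\<in>A. ?D (n + N) x y \<le> r)"
      by (rule diam_less_iff[where B = B, OF \<open>0 < \<xi>\<close>]) (meson BD AM subsetD)
    then have "?D (n + N) x y \<le> \<xi>" if "x \<in> A" "y \<in> A" for x y
      using small that by force
    then have half: "?D n x y \<le> \<epsilon> / 2" if "x \<in> A" "y \<in> A" for x y
      using refine AM that by (meson subsetD)
    then show ?thesis
      using \<open>0 < \<epsilon>\<close> by (subst diam_less_iff[where B = "\<epsilon> / 2"]) (auto intro!: exI[of _ "\<epsilon> / 2"])
  qed
  then show ?thesis using cover cov_mono by metis
qed

section \<open>Capacity and entropy\<close>

theorem theorem3p11:
  fixes M X :: "'a set" and \<rho> d :: "'a \<Rightarrow> 'a \<Rightarrow> real" and f :: "'a \<Rightarrow> 'a" and lam \<xi> :: real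
  assumes "Metric_space M \<rho>"
    and "compact_space (Metric_space.mtopology M \<rho>)"
    and "expansive_homeomorphism M \<rho> f"
    and "self_similar_metric M (Metric_space.mtopology M \<rho>) f lam d"
    and "X \<subseteq> M"
    and "expansive_constant M f d \<xi>"
    and "convergent (entropy_seq M f d \<xi> X)"
  shows "(\<exists>c. (capacity_quotient X d \<longlongrightarrow> c) (at_right 0)) \<and>
         capacity X d = entropy M f d \<xi> X / ln lam"
proof -
  interpret R: Metric_space M \<rho> by fact
  have M: "Metric_space M d" and topo: "Metric_space.mtopology M d = R.mtopology" and lam: "1 < lam"
    using assms(4) by (auto simp: self_similar_metric_def)
  interpret Metric_space M d by fact
  obtain \<xi>0 where "expansive_constant M f d \<xi>0" and
    "\<forall>p\<in>M. \<forall>q\<in>M. d p q \<le> \<xi>0 \<longrightarrow>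
      max (d (f p) (f q)) (d (inv_into M f p) (inv_into M f q)) = lam * d p q"
    using assms(4) unfolding self_similar_metric_def by (elim conjE exE) (rule that)
  then have \<xi>0: "0 < \<xi>0" and expands: "\<And>p q. p \<in> M \<Longrightarrow> q \<in> M \<Longrightarrow> d p q \<le> \<xi>0 \<Longrightarrow>
      max (d (f p) (f q)) (d (inv_into M f p) (inv_into M f q)) = lam * d p q"
    by (simp_all add: expansive_constant_def)
  have comp: "compact_space mtopology" and homeo: "homeomorphic_map mtopology mtopology f"
    using assms(2,3) topo by (simp_all add: expansive_homeomorphism_def)
  have bij: "bij_betw f M M"
    using homeo by (metis bij_betw_def homeomorphic_eq_everything_map topspace_mtopology)
  obtain B where B: "\<And>x y. x \<in> M \<Longrightarrow> y \<in> M \<Longrightarrow> d x y \<le> B"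
    using compactin_imp_mbounded[of M] comp mbounded_alt[of M] by (auto simp: compact_space_def)
  have "0 < \<xi>" using assms(6) by (simp add: expansive_constant_def)
  \<comment> \<open>Below \<open>\<xi>0\<close> time and scale are interchangeable; below \<open>\<xi>\<close> covers compare with those of the given entropy.\<close>
  define \<epsilon> where "\<epsilon> = min \<xi> \<xi>0"
  have \<epsilon>: "0 < \<epsilon>" "\<epsilon> \<le> \<xi>" "\<epsilon> \<le> \<xi>0" using \<open>0 < \<xi>\<close> \<xi>0 by (auto simp: \<epsilon>_def)
  let ?D = "dyn_metric M f d"

  have "diam (?D n) A < \<epsilon> \<longleftrightarrow> diam d A < \<epsilon> / lam ^ n" if "A \<subseteq> X" for A n
    using diam_dyn_metric_less_iff_scaled[OF M bij lam expands B \<epsilon>(1,3)] that assms(5) by blast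
  then have cover_scale: "is_cover \<epsilon> (?D n) X \<A> \<longleftrightarrow> is_cover (\<epsilon> / lam ^ n) d X \<A>" for n \<A>
    unfolding is_cover_def by (metis Union_upper)
  then have cov_scale: "cov \<epsilon> X (?D n) = cov (\<epsilon> / lam ^ n) X d" for n
    by (simp add: cov_def)
  have cover_d: "\<exists>\<A>. is_cover e d X \<A>" if "0 < e" for e
    using is_cover_exists[OF M comp assms(5) that] .
  then have cover_D: "\<exists>\<A>. is_cover \<epsilon> (?D n) X \<A>" for n
    using cover_scale \<epsilon> lam by simp
  have cover_\<xi>: "\<exists>\<A>. is_cover \<xi> (?D n) X \<A>" for n
    using cover_D[of n] \<epsilon> unfolding is_cover_def by (metis less_le_trans)

  obtain N where le_cov: "\<And>n. cov \<epsilon> X (?D n) \<le> cov \<xi> X (?D (n + N))"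
    using cov_dyn_metric_refine[OF M comp homeo assms(6,5) \<epsilon>(1) cover_\<xi>] by blast
  have cov_le: "cov \<xi> X (?D n) \<le> cov \<epsilon> X (?D n)" for n
    using cover_D[of n] \<epsilon> by (auto intro: cov_mono)
  have cov_\<xi>_pos: "0 < cov \<xi> X (?D n)" for n
    using cover_\<xi> cov_pos by blast
  have cov_\<epsilon>_pos: "0 < cov \<epsilon> X (?D n)" for n
    using cover_D cov_pos by blast
  define h where "h = entropy M f d \<xi> X"
  have "entropy_seq M f d \<xi> X \<longlonglongrightarrow> h"
    using assms(7) by (simp add: h_def entropy_def convergent_LIMSEQ_iff)
  moreover have "entropy_seq M f d \<xi> X = (\<lambda>n. ln (real (cov \<xi> X (?D n))) / real n)"
    by (simp add: entropy_seq_def fun_eq_iff)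
  ultimately have "(\<lambda>n. ln (real (cov \<xi> X (?D n))) / real n) \<longlonglongrightarrow> h" by simp
  then have "(\<lambda>n. ln (real (cov \<epsilon> X (?D n))) / real n) \<longlonglongrightarrow> h"
    by (rule tendsto_linear_rate_shift[where N = N])
      (simp_all add: cov_le le_cov cov_\<xi>_pos cov_\<epsilon>_pos)
  then have scales: "(\<lambda>n. ln (real (cov (\<epsilon> / lam ^ n) X d)) / real n) \<longlonglongrightarrow> h"
    by (simp add: cov_scale)
  have anti: "ln (real (cov b X d)) \<le> ln (real (cov a X d))" if "0 < a" "a \<le> b" for a b
  proof -
    have "cov b X d \<le> cov a X d"
      using cover_d[OF \<open>0 < a\<close>] that by (auto intro: cov_mono)
    moreover have "0 < cov b X d"
      using cover_d[of b] cov_pos[of b d X] that by force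
    ultimately show ?thesis by simp
  qed
  have "((\<lambda>e. ln (real (cov e X d)) / (- ln e)) \<longlongrightarrow> h / ln lam) (at_right 0)"
    using capacity_limit_from_geometric_scales[where G = "\<lambda>e. ln (real (cov e X d))",
        OF lam \<epsilon>(1) anti scales] .
  then have "(capacity_quotient X d \<longlongrightarrow> h / ln lam) (at_right 0)"
    by (simp add: capacity_quotient_def[abs_def])
  moreover from this have "capacity X d = h / ln lam"
    unfolding capacity_def by (rule tendsto_Lim[OF trivial_limit_at_right_real])
  ultimately show ?thesis unfolding h_def by blast
qed

end
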